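(* The polynomials $\beta_n(x)$ satisfy the three-term recurrence relation $$\beta_{n+1}(x)=2x\,\beta_{n}(x)-(1+x^{2})\,\beta_{n-1}(x)\qquad (n\ge 1),$$ with initial conditions $\beta_{0}(x)=1$ and $\beta_{1}(x)=2x$.
   Context: For each integer $n\ge 0$, $\beta_n$ is the polynomial with real coefficients determined by $\beta_n(x)=\operatorname{Im}((x+i)^{n+1})$ for real $x$, i.e. $\beta_n(x)=\sum_{k=0}^{\lfloor n/2\rfloor}(-1)^k\binom{n+1}{2k+1}x^{n-2k}$. *)

theory Defs
  imports Complex_Main "HOL-Computational_Algebra.Polynomial"
begin

definition beta :: "nat \<Rightarrow> real poly" where
  "beta n = (\<Sum>k\<le>n div 2. monom ((- 1) ^ k * real ((n + 1) choose (2 * k + 1))) (n - 2 * k))"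

text \<open>
  The coefficient formula above is the polynomial determined by
  \<open>x \<mapsto> Im ((x + \<i>) ^ (n + 1))\<close> on the real line, and it is the only one.
\<close>

lemma poly_beta: "poly (beta n) x = Im ((complex_of_real x + \<i>) ^ (n + 1))"
proof -
  let ?f = "\<lambda>k. real ((n + 1) choose k) * (x ^ (n + 1 - k) * Im (\<i> ^ k))"
  have i_even: "\<i> ^ (2 * k) = complex_of_real ((- 1) ^ k)" for k
    by (simp add: power_mult)
  have Im_even: "Im (\<i> ^ k) = 0" if "even k" for k
    using that by (elim evenE) (simp only: i_even Im_complex_of_real)
  have Im_odd: "Im (\<i> ^ (2 * k + 1)) = (- 1) ^ k" for k
    by (simp only: power_add power_one_right i_even) (simp del: of_real_power)
  have "Im ((complex_of_real x + \<i>) ^ (n + 1)) = Im ((\<i> + complex_of_real x) ^ (n + 1))"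
    by (simp only: add.commute)
  also have "\<dots> = (\<Sum>k\<le>n + 1. Im (of_nat ((n + 1) choose k) * \<i> ^ k * complex_of_real x ^ (n + 1 - k)))"
    by (simp only: binomial_ring Im_sum)
  also have "\<dots> = (\<Sum>k\<le>n + 1. ?f k)"
  proof (rule sum.cong[OF refl])
    fix k
    have "of_nat ((n + 1) choose k) * \<i> ^ k * complex_of_real x ^ (n + 1 - k)
        = complex_of_real (real ((n + 1) choose k) * x ^ (n + 1 - k)) * \<i> ^ k"
      by (simp add: mult_ac)
    then show "Im (of_nat ((n + 1) choose k) * \<i> ^ k * complex_of_real x ^ (n + 1 - k)) = ?f k"
      by (simp only: Im_complex_of_real Re_complex_of_real times_complex.sel mult_zero_left mult_zero_right add_0_right mult.assoc)
  qed
  also have "\<dots> = (\<Sum>k\<in>{k. k \<le> n + 1 \<and> odd k}. ?f k)"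
    by (rule sum.mono_neutral_right) (auto simp: Im_even)
  also have "\<dots> = (\<Sum>k\<le>n div 2. ?f (2 * k + 1))"
    by (rule sum.reindex_bij_witness[of _ "\<lambda>k. 2 * k + 1" "\<lambda>k. k div 2"])
      (auto elim!: oddE)
  also have "\<dots> = poly (beta n) x"
    unfolding beta_def poly_sum
    by (intro sum.cong refl) (simp only: Im_odd poly_monom, simp add: mult_ac)
  finally show ?thesis by simp
qed

lemma beta_unique:
  assumes "\<And>x. poly p x = Im ((complex_of_real x + \<i>) ^ (n + 1))"
  shows "p = beta n"
  using assms by (intro poly_eq_poly_eq_iff[THEN iffD1] ext) (simp only: poly_beta)

end

theory Submission
  imports Defs
begin

text \<open>
  The number \<open>z = x + \<i>\<close> is a root of \<open>z\<^sup>2 - 2 x z + (1 + x\<^sup>2)\<close>. Multiplying this relation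
  by \<open>z ^ n\<close> and taking imaginary parts gives the recurrence at every real \<open>x\<close>.
\<close>

lemma poly_beta_Suc_Suc:
  "poly (beta (Suc (Suc n))) x = 2 * x * poly (beta (Suc n)) x - (1 + x\<^sup>2) * poly (beta n) x"
proof -
  define z where "z = complex_of_real x + \<i>"
  have root: "z\<^sup>2 = of_real (2 * x) * z - of_real (1 + x\<^sup>2)"
    by (simp add: z_def complex_eq_iff power2_eq_square)
  have "z ^ (n + 3) = z\<^sup>2 * z ^ (n + 1)"
    by (simp add: eval_nat_numeral)
  also have "\<dots> = of_real (2 * x) * z ^ (n + 2) - of_real (1 + x\<^sup>2) * z ^ (n + 1)"
    unfolding root by (simp add: algebra_simps)
  \<comment> \<open>Both coefficients are embedded reals, so \<open>Im\<close> commutes with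
    multiplication by them.\<close>
  finally have "Im (z ^ (n + 3)) = 2 * x * Im (z ^ (n + 2)) - (1 + x\<^sup>2) * Im (z ^ (n + 1))"
    by (simp only: minus_complex.sel times_complex.sel Re_complex_of_real Im_complex_of_real
        mult_zero_left add_0_right)
  then show ?thesis
    by (simp add: poly_beta z_def eval_nat_numeral)
qed

theorem theorem4:
  shows "(\<forall>n\<ge>1. beta (n + 1) = [:0, 2:] * beta n - [:1, 0, 1:] * beta (n - 1))
    \<and> beta 0 = 1 \<and> beta 1 = [:0, 2:]"
proof (intro conjI allI impI)
  fix n :: nat
  assume "n \<ge> 1"
  then obtain m where n: "n = Suc m"
    by (cases n) auto
  \<comment> \<open>A real polynomial is determined by its values, so a pointwise identity suffices;
    with \<open>n = Suc m\<close>, the truncated \<open>n - 1\<close> is \<open>m\<close>.\<close>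
  have "poly (beta (n + 1)) x = poly ([:0, 2:] * beta n - [:1, 0, 1:] * beta (n - 1)) x" for x
    by (simp add: n poly_beta_Suc_Suc power2_eq_square algebra_simps)
  then show "beta (n + 1) = [:0, 2:] * beta n - [:1, 0, 1:] * beta (n - 1)"
    by (intro poly_eq_poly_eq_iff[THEN iffD1] ext)
next
  \<comment> \<open>As \<open>0 div 2\<close> and \<open>1 div 2\<close> are both 0, each initial
    sum has only the term \<open>k = 0\<close>.\<close>
  show "beta 0 = 1"
    by (simp add: beta_def)
  show "beta 1 = [:0, 2:]"
    by (simp add: beta_def monom_altdef)
qed

end
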